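(* Let $b\in\omega$ with $b\geq 2$ and let $\varepsilon>0$. Put $t(\varepsilon)=t_{b^k-1}$ with $k=\lfloor\log_2(1/\varepsilon)\rfloor+1$, where $(t_j)_{j\ge1}$ is the sequence of odd tangent numbers. Then there exists a coloring (i.e. a map) $c:C^{\uparrow}_{\mathrm{sur}}(b^\omega)\to t(\varepsilon)=\{0,\dots,t(\varepsilon)-1\}$ such that for every $B\subseteq t(\varepsilon)$: if there exists $h\in C^{\uparrow}_{\mathrm{sur}}(b^\omega)$ such that for every $f\in C^{\uparrow}_{\mathrm{sur}}(b^\omega)$ there exists $g\in C^{\uparrow}_{\mathrm{sur}}(b^\omega)$ with $\rho_\infty(f\circ h,g)<\varepsilon$ and $c(g)\in B$, then $B=t(\varepsilon)$.
   Context: $\omega=\{0,1,2,\dots\}$ and $n\in\omega$ is identified with $\{0,\dots,n-1\}$. $b^\omega$ is the set of infinite sequences with values in $\{0,\dots,b-1\}$. For distinct $x,y\in b^\omega$, $\rho_b(x,y)=2^{-n_0}$ with $n_0=\min\{n:x(n)\neq y(n)\}$ (and $\rho_b(x,x)=0$). The lexicographic linear order is: $x\leq_{\mathrm{lex}}y$ iff $x=y$ or $x(n_0)<y(n_0)$ with $n_0=\min\{n:x(n)\neq y(n)\}$. $C^{\uparrow}_{\mathrm{sur}}(b^\omega)$ is the set of all maps $f:b^\omega\to b^\omega$ that are continuous, onto and nondecreasing ($x\leq_{\mathrm{lex}}y$ implies $f(x)\leq_{\mathrm{lex}}f(y)$), with metric $\rho_\infty(f,g)=\sup\{\rho_b(f(x),g(x)):x\in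 b^\omega\}$. The odd tangent numbers are $t_j=\tan^{(2j-1)}(0)$, the value at $0$ of the $(2j-1)$-th derivative of $\tan$, for each positive integer $j$.
   Formalization: For ε > 1 one has k ≤ 0, so b^k − 1 is not a positive integer and t_{b^k−1} is undefined; there the number of colors t(ε) is set to 1. For 0 < ε ≤ 1 the claim is unchanged. *)

theory Defs
  imports "HOL-Analysis.Analysis" "HOL-Computational_Algebra.Polynomial"
begin

definition seqs :: "nat \<Rightarrow> (nat \<Rightarrow> nat) set" where
  "seqs b = (UNIV \<rightarrow> {0..<b})"

definition first_diff :: "(nat \<Rightarrow> nat) \<Rightarrow> (nat \<Rightarrow> nat) \<Rightarrow> nat" where
  "first_diff x y = (LEAST n. x n \<noteq> y n)"

definition seq_dist :: "(nat \<Rightarrow> nat) \<Rightarrow> (nat \<Rightarrow> nat) \<Rightarrow> real" where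
  "seq_dist x y = (if x = y then 0 else 1 / 2 ^ first_diff x y)"

definition lex_le :: "(nat \<Rightarrow> nat) \<Rightarrow> (nat \<Rightarrow> nat) \<Rightarrow> bool" where
  "lex_le x y \<longleftrightarrow> x = y \<or> x (first_diff x y) < y (first_diff x y)"

lemma Metric_space_seqs: "Metric_space (seqs b) seq_dist"
proof
  show "0 \<le> seq_dist x y" for x y
    by (simp add: seq_dist_def)
  show "seq_dist x y = seq_dist y x" for x y
    by (simp add: seq_dist_def first_diff_def eq_commute)
  show "seq_dist x y = 0 \<longleftrightarrow> x = y" for x y
    by (simp add: seq_dist_def)
  show "seq_dist x z \<le> seq_dist x y + seq_dist y z" for x y z
  proof (cases "x = z \<or> x = y \<or> y = z")
    case True
    then show ?thesis by (auto simp: seq_dist_def)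
  next
    case False
    then obtain n where "x n \<noteq> z n" by (auto simp: fun_eq_iff)
    then have "x (first_diff x z) \<noteq> z (first_diff x z)"
      unfolding first_diff_def by (rule LeastI)
    then have "x (first_diff x z) \<noteq> y (first_diff x z) \<or> y (first_diff x z) \<noteq> z (first_diff x z)"
      by auto
    then have "first_diff x y \<le> first_diff x z \<or> first_diff y z \<le> first_diff x z"
      by (metis (mono_tags, lifting) Least_le first_diff_def)
    then have "1 / 2 ^ first_diff x z \<le> (1 / 2 ^ first_diff x y :: real) \<or>
               1 / 2 ^ first_diff x z \<le> (1 / 2 ^ first_diff y z :: real)"
      by (auto simp: frac_le)
    then show ?thesis
      using False by (auto simp: seq_dist_def add_increasing add_increasing2)
  qed
qed

text \<open>Maps on \<^term>\<open>seqs b\<close> are taken extensional, so that equality of HOL functions is equality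
  of maps and a coloring cannot depend on values outside the domain.\<close>

definition C_sur :: "nat \<Rightarrow> ((nat \<Rightarrow> nat) \<Rightarrow> (nat \<Rightarrow> nat)) set" where
  "C_sur b = {f \<in> extensional (seqs b).
     continuous_map (Metric_space.mtopology (seqs b) seq_dist)
                    (Metric_space.mtopology (seqs b) seq_dist) f \<and>
     f ` seqs b = seqs b \<and>
     monotone_on (seqs b) lex_le lex_le f}"

definition sup_dist ::
  "nat \<Rightarrow> ((nat \<Rightarrow> nat) \<Rightarrow> (nat \<Rightarrow> nat)) \<Rightarrow> ((nat \<Rightarrow> nat) \<Rightarrow> (nat \<Rightarrow> nat)) \<Rightarrow> real" where
  "sup_dist b f g = (SUP x\<in>seqs b. seq_dist (f x) (g x))"

text \<open>The floor only converts the type: see \<open>of_nat_odd_tangent\<close> below.\<close>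

definition odd_tangent :: "nat \<Rightarrow> nat" where
  "odd_tangent j = nat \<lfloor>(deriv ^^ (2 * j - 1)) tan (0::real)\<rfloor>"

lemma higher_deriv_tan_poly:
  "\<exists>p :: real poly. (\<forall>i. coeff p i \<in> \<nat>) \<and>
     (\<forall>x. cos x \<noteq> 0 \<longrightarrow> (deriv ^^ n) tan x = poly p (tan x))"
proof (induction n)
  case 0
  show ?case
    by (rule exI[of _ "[:0, 1:]"]) (auto simp: coeff_pCons split: nat.split)
next
  case (Suc n)
  then obtain p :: "real poly" where coeff_p: "\<And>i. coeff p i \<in> \<nat>"
    and p: "\<And>x. cos x \<noteq> 0 \<Longrightarrow> (deriv ^^ n) tan x = poly p (tan x)"
    by blast
  define q where "q = pderiv p + pCons 0 (pCons 0 (pderiv p))"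
  have coeff_dp: "coeff (pderiv p) i \<in> \<nat>" for i
    unfolding coeff_pderiv by (intro Nats_mult coeff_p of_nat_in_Nats)
  have "coeff q i \<in> \<nat>" for i
    unfolding q_def coeff_add
    by (intro Nats_add coeff_dp) (auto simp: coeff_pCons coeff_dp split: nat.split)
  moreover have "(deriv ^^ Suc n) tan x = poly q (tan x)" if "cos x \<noteq> 0" for x
  proof -
    have "open {x::real. cos x \<noteq> 0}"
      by (intro open_Collect_neq continuous_intros)
    then have "eventually (\<lambda>y. cos y \<noteq> 0) (nhds x)"
      using that eventually_nhds_in_open[of "{x. cos x \<noteq> 0}" x] by simp
    then have "eventually (\<lambda>y. (deriv ^^ n) tan y = poly p (tan y)) (nhds x)"
      by eventually_elim (rule p)
    then have "(deriv ^^ Suc n) tan x = deriv (\<lambda>y. poly p (tan y)) x"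
      by (simp add: deriv_cong_ev)
    also have "\<dots> = poly (pderiv p) (tan x) * inverse ((cos x)\<^sup>2)"
      by (intro DERIV_imp_deriv DERIV_chain2[OF poly_DERIV DERIV_tan] that)
    also have "\<dots> = poly q (tan x)"
    proof -
      have "inverse ((cos x)\<^sup>2) = 1 + (tan x)\<^sup>2"
        using tan_sec[OF that] by (simp add: power_inverse)
      then show ?thesis
        by (simp add: q_def power2_eq_square algebra_simps)
    qed
    finally show ?thesis .
  qed
  ultimately show ?case by blast
qed

lemma of_nat_odd_tangent: "real (odd_tangent j) = (deriv ^^ (2 * j - 1)) tan (0::real)"
proof -
  obtain p :: "real poly" where "\<And>i. coeff p i \<in> \<nat>"
    and "\<And>x. cos x \<noteq> 0 \<Longrightarrow> (deriv ^^ (2 * j - 1)) tan x = poly p (tan x)"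
    using higher_deriv_tan_poly[of "2 * j - 1"] by blast
  then have "(deriv ^^ (2 * j - 1)) tan (0::real) \<in> \<nat>"
    by (simp add: poly_0_coeff_0)
  then show ?thesis
    by (auto simp: odd_tangent_def elim!: Nats_cases)
qed

text \<open>For \<open>\<epsilon> > 1\<close> the exponent \<open>\<lfloor>log\<^sub>2 (1/\<epsilon>)\<rfloor> + 1\<close> is not positive, so \<open>b ^ k - 1\<close> is not the index
  of an odd tangent number. There the number of colors is 1 by convention, which is the only
  choice: all distances are at most 1, so any nonempty set of colors actually used is hit.\<close>

definition num_colors :: "nat \<Rightarrow> real \<Rightarrow> nat" where
  "num_colors b \<epsilon> =
     (if \<epsilon> \<le> 1 then odd_tangent (b ^ nat (\<lfloor>log 2 (1 / \<epsilon>)\<rfloor> + 1) - 1) else 1)"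

end

theory Submission
  imports Defs
begin

text \<open>Maps agree up to \<open>\<epsilon>\<close> as soon as they agree on the first \<open>k\<close> digits, and the first \<open>k\<close>
  digits of a map \<open>g\<close> amount to \<open>b ^ k - 1\<close> proper clopen initial segments (cuts) of \<open>b\<^sup>\<omega>\<close>, the
  preimages under \<open>g\<close> of the cuts of level \<open>k\<close>. The cuts form a countable dense linear order, every
  set of \<open>b ^ k - 1\<close> cuts comes from some \<open>f\<close>, and \<open>h\<close> embeds this order into itself. So the claim
  is the lower bound in Devlin's theorem on finite subsets of the rationals.

  Rank the cuts by natural numbers and consume a finite set \<open>X\<close> of cuts as follows. Keep a list of
  consecutive blocks, initially \<open>[X]\<close>, and repeatedly take the block whose convex hull has the element
  of least rank: if the block is this single element, delete the block; otherwise split it there.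
  The record of the choices made is the color. With \<open>m\<close> blocks there are \<open>m\<close> choices of a block, and
  the number of blocks decreases or increases by 1, just as the derivative of \<open>tan\<^sup>m\<close> is
  \<open>m tan\<^bsup>m-1\<^esup> + m tan\<^bsup>m+1\<^esup>\<close>; hence the number of colors is a tangent number. In any subset that is
  dense in itself every record can be realized, by carrying out the process on intervals from
  which all elements of low rank have been removed.\<close>

section \<open>Tangent numbers as numbers of weighted walks\<close>

text \<open>Weighted count of walks of length \<open>l\<close> from \<open>k\<close> to
  \<open>0\<close> on the naturals, each step from \<open>k\<close> up or down having weight
  \<open>k\<close>. The weight \<open>0\<close> at \<open>k = 0\<close> stops walks there and makes
  the truncated \<open>k - 1\<close> harmless.\<close>

primrec walks :: "nat \<Rightarrow> nat \<Rightarrow> nat" where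
  "walks 0 k = (if k = 0 then 1 else 0)"
| "walks (Suc l) k = k * (walks l (k - 1) + walks l (Suc k))"

text \<open>As the derivative of tan is 1 + tan^2, this is what differentiation becomes on
  polynomials in tan.\<close>

definition tan_deriv :: "real poly \<Rightarrow> real poly" where
  "tan_deriv p = pderiv p * [:1, 0, 1:]"

lemma higher_deriv_poly_tan:
  assumes "cos x \<noteq> 0"
  shows "(deriv ^^ n) (\<lambda>x. poly p (tan x)) x = poly ((tan_deriv ^^ n) p) (tan (x::real))"
  using assms
proof (induction n arbitrary: x)
  case 0
  then show ?case by simp
next
  case (Suc n)
  have "open {x::real. cos x \<noteq> 0}"
    by (intro open_Collect_neq continuous_intros)
  then have "eventually (\<lambda>y. cos y \<noteq> 0) (nhds x)"
    using Suc.prems eventually_nhds_in_open[of "{x. cos x \<noteq> 0}" x] by simp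
  then have "eventually (\<lambda>y. (deriv ^^ n) (\<lambda>x. poly p (tan x)) y =
      poly ((tan_deriv ^^ n) p) (tan y)) (nhds x)"
    by eventually_elim (rule Suc.IH)
  then have "(deriv ^^ Suc n) (\<lambda>x. poly p (tan x)) x =
      deriv (\<lambda>y. poly ((tan_deriv ^^ n) p) (tan y)) x"
    by (simp add: deriv_cong_ev)
  also have "\<dots> = poly (pderiv ((tan_deriv ^^ n) p)) (tan x) * inverse ((cos x)\<^sup>2)"
    by (intro DERIV_imp_deriv DERIV_chain2[OF poly_DERIV DERIV_tan] Suc.prems)
  also have "inverse ((cos x)\<^sup>2) = 1 + (tan x)\<^sup>2"
    using tan_sec[OF Suc.prems] by (simp add: power_inverse)
  finally show ?case
    by (simp add: tan_deriv_def power2_eq_square algebra_simps)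
qed

lemma tan_deriv_linear: "tan_deriv (smult c (p + q)) = smult c (tan_deriv p + tan_deriv q)"
  by (simp add: tan_deriv_def pderiv_add pderiv_smult algebra_simps)

lemma tan_deriv_funpow_linear:
  "(tan_deriv ^^ n) (smult c (p + q)) = smult c ((tan_deriv ^^ n) p + (tan_deriv ^^ n) q)"
  by (induction n) (simp_all add: tan_deriv_linear)

lemma tan_deriv_monom:
  "tan_deriv (monom 1 k) = smult (of_nat k) (monom 1 (k - 1) + monom 1 (Suc k))"
proof (cases k)
  case (Suc m)
  have "[:1, 0, 1::real:] = monom 1 0 + monom 1 2"
    by (simp add: monom_altdef power2_eq_square)
  then show ?thesis
    by (simp add: Suc tan_deriv_def pderiv_monom distrib_left mult_monom smult_add_right smult_monom)
qed (simp add: tan_deriv_def pderiv_monom)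

lemma coeff_tan_deriv_monom:
  "coeff ((tan_deriv ^^ n) (monom 1 k)) 0 = of_nat (walks n k)"
proof (induction n arbitrary: k)
  case (Suc n)
  show ?case
    \<comment> \<open>Peeling off the innermost application leaves \<open>n\<close> applications to
      the two neighbouring monomials, which is the first step of a walk from
      \<open>k\<close>.\<close>
    unfolding funpow_Suc_right o_apply tan_deriv_monom tan_deriv_funpow_linear
    by (simp add: Suc)
qed simp

theorem odd_tangent_eq_walks: "odd_tangent j = walks (2 * j - 1) 1"
proof -
  have "(deriv ^^ (2 * j - 1)) tan (0::real) =
      (deriv ^^ (2 * j - 1)) (\<lambda>x. poly (monom 1 1) (tan x)) 0"
    by (simp add: poly_monom)
  also have "\<dots> = of_nat (walks (2 * j - 1) 1)"
    unfolding coeff_tan_deriv_monom[symmetric]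
    by (subst higher_deriv_poly_tan) (simp_all add: poly_0_coeff_0)
  finally show ?thesis
    unfolding of_nat_odd_tangent[symmetric] by (simp only: of_nat_eq_iff)
qed

text \<open>Prepending the steps 1, 2, 1 to a walk from 1 lengthens it by 2 without losing weight.
  Positivity provides a default color later on.\<close>

lemma walks_odd_pos: "0 < walks (Suc (2 * j)) 1"
proof (induction j)
  case (Suc j)
  have "walks (Suc (2 * j)) 1 \<le> walks (Suc (Suc (2 * j))) 2"
    by (simp del: walks.simps(2) add: walks.simps(2)[of "Suc (2*j)"])
  also have "\<dots> \<le> walks (Suc (2 * Suc j)) 1"
    by (simp add: numeral_2_eq_2)
  finally show ?case using Suc by linarith
qed simp

section \<open>Colors of finite subsets of a countable order\<close>

text \<open>The hull is taken in the ambient \<open>Q\<close>, so that colors do not refer to the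
  subset from which \<open>X\<close> was chosen; a pivot may therefore lie outside \<open>X\<close>.
  The order is only partial because the intended instance is inclusion of sets.\<close>

definition order_hull :: "'a::order set \<Rightarrow> 'a set \<Rightarrow> 'a set" where
  "order_hull Q X = {z \<in> Q. \<exists>x\<in>X. \<exists>y\<in>X. x \<le> z \<and> z \<le> y}"

definition pivot :: "'a::order set \<Rightarrow> ('a \<Rightarrow> nat) \<Rightarrow> 'a set \<Rightarrow> 'a" where
  "pivot Q r X = arg_min r (\<lambda>z. z \<in> order_hull Q X)"

definition first_block :: "'a::order set \<Rightarrow> ('a \<Rightarrow> nat) \<Rightarrow> 'a set list \<Rightarrow> nat" where
  "first_block Q r Xs = (THE i. i < length Xs \<and>
     (\<forall>j < length Xs. j \<noteq> i \<longrightarrow> r (pivot Q r (Xs ! i)) < r (pivot Q r (Xs ! j))))"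

text \<open>Mixed-radix code of the record: each block number has \<open>a + c\<close> codes, the
  first \<open>a\<close> for deletions and the other \<open>c\<close> for splits. Thus
  \<open>walks l m\<close> codes are reserved for records of \<open>l\<close> steps starting with
  \<open>m\<close> blocks.\<close>

primrec colour :: "'a::order set \<Rightarrow> ('a \<Rightarrow> nat) \<Rightarrow> nat \<Rightarrow> 'a set list \<Rightarrow> nat" where
  "colour Q r 0 Xs = 0"
| "colour Q r (Suc l) Xs =
    (let i = first_block Q r Xs; X = Xs ! i; p = pivot Q r X;
         a = walks l (length Xs - 1); c = walks l (Suc (length Xs))
     in i * (a + c) +
        (if X = {p} then colour Q r l (take i Xs @ drop (Suc i) Xs)
         else a + colour Q r l (take i Xs @ {x \<in> X. x < p} # {x \<in> X. p < x} # drop (Suc i) Xs)))"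

lemma pivot_eq:
  assumes "inj_on r Q" "z \<in> order_hull Q X" "\<And>w. w \<in> order_hull Q X \<Longrightarrow> r z \<le> r w"
  shows "pivot Q r X = z"
proof -
  have p: "pivot Q r X \<in> order_hull Q X" "r (pivot Q r X) \<le> r z"
    unfolding pivot_def using arg_min_nat_lemma[of "\<lambda>z. z \<in> order_hull Q X" z r] assms(2) by auto
  then have "r (pivot Q r X) = r z"
    using assms(3) by (simp add: order_antisym)
  then show ?thesis
    using assms(1,2) p(1) by (auto simp: order_hull_def dest: inj_onD)
qed

lemma pivot_in_order_hull:
  assumes "X \<noteq> {}" "X \<subseteq> Q"
  shows "pivot Q r X \<in> order_hull Q X"
proof -
  obtain x where "x \<in> X" using assms(1) by blast
  then have "x \<in> order_hull Q X" using assms(2) by (auto simp: order_hull_def)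
  then show ?thesis
    unfolding pivot_def by (rule arg_min_natI)
qed

lemma first_block_eq:
  assumes "\<And>Y. Y \<in> set Us \<union> set Vs \<Longrightarrow> r (pivot Q r X) < r (pivot Q r Y)"
  shows "first_block Q r (Us @ X # Vs) = length Us"
proof -
  let ?Xs = "Us @ X # Vs"
  have less: "r (pivot Q r X) < r (pivot Q r (?Xs ! j))" if "j < length ?Xs" "j \<noteq> length Us" for j
  proof (rule assms)
    show "?Xs ! j \<in> set Us \<union> set Vs"
      using that by (cases "j < length Us") (auto simp: nth_append nth_Cons split: nat.split)
  qed
  show ?thesis
    unfolding first_block_def
  proof (rule the_equality)
    show "length Us < length ?Xs \<and> (\<forall>j < length ?Xs. j \<noteq> length Us \<longrightarrow>
        r (pivot Q r (?Xs ! length Us)) < r (pivot Q r (?Xs ! j)))"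
      using less by simp
    fix i
    assume i: "i < length ?Xs \<and> (\<forall>j < length ?Xs. j \<noteq> i \<longrightarrow>
        r (pivot Q r (?Xs ! i)) < r (pivot Q r (?Xs ! j)))"
    show "i = length Us"
    proof (rule ccontr)
      assume "i \<noteq> length Us"
      moreover have "length Us < length ?Xs" by simp
      ultimately have "r (pivot Q r (?Xs ! i)) < r (pivot Q r (?Xs ! length Us))"
        using i by blast
      then show False
        using less[of i] i \<open>i \<noteq> length Us\<close> by simp
    qed
  qed
qed

section \<open>Realizing every color inside a subset dense in itself\<close>

definition dense_in_itself :: "'a::order set \<Rightarrow> bool" where
  "dense_in_itself S \<longleftrightarrow> (\<forall>a\<in>S. \<forall>c\<in>S. a < c \<longrightarrow> (\<exists>s\<in>S. a < s \<and> s < c))"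

lemma dense_in_itselfD:
  "dense_in_itself S \<Longrightarrow> a \<in> S \<Longrightarrow> c \<in> S \<Longrightarrow> a < c \<Longrightarrow> \<exists>s\<in>S. a < s \<and> s < c"
  by (auto simp: dense_in_itself_def)

text \<open>Each \<open>z\<close> in \<open>F\<close> is avoided by dividing the interval at some
  \<open>s\<close> in \<open>S\<close>: the upper part misses \<open>z\<close> if
  \<open>z < s\<close>, and otherwise the lower part does, even in a partial order.\<close>

lemma dense_avoid_finite:
  assumes "dense_in_itself S" "finite F" "a \<in> S" "c \<in> S" "a < c"
  shows "\<exists>a'\<in>S. \<exists>c'\<in>S. a \<le> a' \<and> a' < c' \<and> c' \<le> c \<and> {a'<..<c'} \<inter> F = {}"
  using assms(2)
proof (induction F)
  case empty
  then show ?case using assms by auto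
next
  case (insert z F)
  then obtain a' c' where *: "a' \<in> S" "c' \<in> S" "a \<le> a'" "a' < c'" "c' \<le> c" "{a'<..<c'} \<inter> F = {}"
    by blast
  then obtain s where s: "s \<in> S" "a' < s" "s < c'"
    using dense_in_itselfD[OF assms(1)] by blast
  show ?case
  proof (cases "z < s")
    case True
    have "{s<..<c'} \<subseteq> {a'<..<c'}" "z \<notin> {s<..<c'}"
      using s True by (auto dest: less_trans)
    then have "{s<..<c'} \<inter> insert z F = {}"
      using *(6) by blast
    then show ?thesis using * s by (meson less_imp_le order_trans)
  next
    case False
    have "{a'<..<s} \<subseteq> {a'<..<c'}" "z \<notin> {a'<..<s}"
      using s False by (auto dest: less_trans)
    then have "{a'<..<s} \<inter> insert z F = {}"
      using *(6) by blast
    then show ?thesis using * s by (meson less_imp_le order_trans)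
  qed
qed

lemma dense_high_rank:
  fixes r :: "'a::order \<Rightarrow> nat"
  assumes "dense_in_itself S" "inj_on r Q" "a \<in> S" "c \<in> S" "a < c"
  shows "\<exists>a'\<in>S. \<exists>c'\<in>S. a \<le> a' \<and> a' < c' \<and> c' \<le> c \<and>
           (\<forall>z\<in>Q. a' < z \<longrightarrow> z < c' \<longrightarrow> K < r z)"
proof -
  have "finite (r -` {..K} \<inter> Q)"
    using assms(2) by (intro finite_vimage_IntI) auto
  from dense_avoid_finite[OF assms(1) this assms(3-5)] show ?thesis
    by (fastforce simp: not_le)
qed

text \<open>Invariant of the construction: the block stays in the interval assigned to it, and the
  rank bound on its whole hull makes its pivot come after any pivot of rank at most
  \<open>K\<close>.\<close>

definition good_block ::
    "'a::order set \<Rightarrow> ('a \<Rightarrow> nat) \<Rightarrow> 'a set \<Rightarrow> nat \<Rightarrow> 'a \<times> 'a \<Rightarrow> 'a set \<Rightarrow> bool" where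
  "good_block Q r S K I X \<longleftrightarrow> finite X \<and> X \<noteq> {} \<and> X \<subseteq> S \<inter> {fst I<..<snd I} \<and>
     (\<forall>z\<in>order_hull Q X. K < r z)"

lemma good_block_mono:
  "good_block Q r S K I X \<Longrightarrow> K' \<le> K \<Longrightarrow> good_block Q r S K' I X"
  by (auto simp: good_block_def)

lemma good_block_pivot:
  "good_block Q r S K I X \<Longrightarrow> S \<subseteq> Q \<Longrightarrow> K < r (pivot Q r X)"
  using pivot_in_order_hull[of X Q r] by (auto simp: good_block_def)

lemma good_blocks_pivot:
  "list_all2 (good_block Q r S K) Is Xs \<Longrightarrow> S \<subseteq> Q \<Longrightarrow> X \<in> set Xs \<Longrightarrow> K < r (pivot Q r X)"
  by (auto simp: in_set_conv_nth dest!: list_all2_nthD2 good_block_pivot)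

lemma good_blocks_mono:
  "list_all2 (good_block Q r S K) Is Xs \<Longrightarrow> K' \<le> K \<Longrightarrow> list_all2 (good_block Q r S K') Is Xs"
  by (erule list_all2_mono) (rule good_block_mono)

text \<open>Induction on the number of steps, with intervals and rank bound free. The first pivot is
  fixed before the other blocks are built, and its rank is the bound passed to the induction
  hypothesis, so its block is indeed chosen first. Each deletion uses up one element and a split
  none; going from \<open>length Is\<close> blocks to none in \<open>l\<close> steps takes
  \<open>(l + length Is) / 2\<close> deletions.\<close>

theorem colour_persistent:
  assumes S: "S \<subseteq> Q" "dense_in_itself S" and inj: "inj_on r Q"
    and "v < walks l (length Is)" "\<forall>(a, c) \<in> set Is. a \<in> S \<and> c \<in> S \<and> a < c"
  shows "\<exists>Xs. list_all2 (good_block Q r S K) Is Xs \<and> colour Q r l Xs = v \<and>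
           2 * sum_list (map card Xs) = l + length Is"
  using assms(4,5)
proof (induction l arbitrary: Is K v)
  case 0
  \<comment> \<open>\<open>walks 0\<close> vanishes except at \<open>0\<close>, so \<open>Is\<close>
    is empty.\<close>
  then show ?case by (auto split: if_splits)
next
  case (Suc l)
  define A where "A = walks l (length Is - 1)"
  define C where "C = walks l (Suc (length Is))"
  \<comment> \<open>Decoding \<open>v\<close>: block \<open>i\<close> is processed first;
    \<open>w < A\<close> demands a deletion, any other \<open>w\<close> a split with remaining code
    \<open>w - A\<close>.\<close>
  define i where "i = v div (A + C)"
  define w where "w = v mod (A + C)"
  have v: "v < length Is * (A + C)"
    using Suc.prems(1) by (simp add: A_def C_def)
  then have "0 < A + C" by (cases "A + C") auto
  then have w: "w < A + C" by (simp add: w_def)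
  have i: "i < length Is"
    using v by (simp add: i_def less_mult_imp_div_less)
  have v_eq: "v = i * (A + C) + w"
    unfolding i_def w_def by (rule div_mult_mod_eq[symmetric])
  obtain a c where ac: "Is ! i = (a, c)" by fastforce
  obtain Us Vs where Is: "Is = Us @ (a, c) # Vs" and len: "length Us = i"
    using id_take_nth_drop[OF i] ac i by (metis length_take min.absorb4)
  have intervals: "\<forall>(a, c) \<in> set Us. a \<in> S \<and> c \<in> S \<and> a < c"
      "\<forall>(a, c) \<in> set Vs. a \<in> S \<and> c \<in> S \<and> a < c"
    and "a \<in> S" "c \<in> S" "a < c"
    using Suc.prems(2) by (auto simp: Is)
  from dense_high_rank[OF S(2) inj this(3-5), of K]
  obtain a' c' where a'c': "a' \<in> S" "c' \<in> S" "a \<le> a'" "a' < c'" "c' \<le> c"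
    and high: "\<And>z. z \<in> Q \<Longrightarrow> a' < z \<Longrightarrow> z < c' \<Longrightarrow> K < r z"
    by blast
  obtain s where s: "s \<in> S" "a' < s" "s < c'"
    using dense_in_itselfD[OF S(2) a'c'(1,2,4)] by blast
  show ?case
  proof (cases "w < A")
    case True
    have "w < walks l (length (Us @ Vs))"
      using True by (simp add: A_def Is)
    moreover have "\<forall>(a, c) \<in> set (Us @ Vs). a \<in> S \<and> c \<in> S \<and> a < c"
      using intervals by auto
    ultimately obtain Ys where Ys: "list_all2 (good_block Q r S (r s)) (Us @ Vs) Ys"
      "colour Q r l Ys = w" "2 * sum_list (map card Ys) = l + length (Us @ Vs)"
      using Suc.IH by blast
    from Ys(1) obtain Xs Zs where XZ: "Ys = Xs @ Zs" "length Xs = length Us"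
      "list_all2 (good_block Q r S (r s)) Us Xs" "list_all2 (good_block Q r S (r s)) Vs Zs"
      by (auto simp: list_all2_append1)
    have order_hull: "order_hull Q {s} = {s}" using s(1) S(1) by (auto simp: order_hull_def)
    have pivot: "pivot Q r {s} = s"
      by (rule pivot_eq[OF inj]) (auto simp: order_hull)
    have K: "K < r s" using high s S(1) by auto
    have good: "good_block Q r S K (a, c) {s}"
      using s a'c' K by (auto simp: good_block_def order_hull)
    have first: "first_block Q r (Xs @ {s} # Zs) = i"
      using good_blocks_pivot[OF XZ(3) S(1)] good_blocks_pivot[OF XZ(4) S(1)]
        first_block_eq[of Xs Zs r Q "{s}"] by (auto simp: pivot XZ len)
    have lenXZ: "length (Xs @ {s} # Zs) = length Is"
      using XZ(2-4) by (auto simp: Is dest: list_all2_lengthD)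
    have "colour Q r (Suc l) (Xs @ {s} # Zs) = i * (A + C) + colour Q r l (Xs @ Zs)"
      using XZ(2) len unfolding colour.simps first Let_def lenXZ A_def C_def
      by (simp add: nth_append pivot)
    then have "colour Q r (Suc l) (Xs @ {s} # Zs) = v"
      using Ys(2) XZ(1) v_eq by simp
    moreover have "list_all2 (good_block Q r S K) Is (Xs @ {s} # Zs)"
      unfolding Is using good good_blocks_mono[OF XZ(3)] good_blocks_mono[OF XZ(4)] K
      by (intro list_all2_appendI) auto
    moreover have "2 * sum_list (map card (Xs @ {s} # Zs)) = Suc l + length Is"
      using Ys(3) by (simp add: XZ(1) Is)
    ultimately show ?thesis by blast
  next
    case False
    text \<open>Elements of \<open>Q\<close> may lie next to \<open>a'\<close> or \<open>c'\<close> without any element of \<open>S\<close> in between,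
      so the new pivot is chosen among those with elements of \<open>S\<close> on both sides.\<close>
    define M where "M = {z \<in> Q. (\<exists>s\<in>S. a' < s \<and> s < z) \<and> (\<exists>s\<in>S. z < s \<and> s < c')}"
    have MI: "z \<in> M" if z: "z \<in> Q" "x \<in> S" "a' < x" "x \<le> z" "y \<in> S" "y < c'" "z \<le> y" for x y z
    proof -
      obtain x' where x': "x' \<in> S" "a' < x'" "x' < x"
        using dense_in_itselfD[OF S(2) a'c'(1) z(2,3)] by blast
      obtain y' where y': "y' \<in> S" "y < y'" "y' < c'"
        using dense_in_itselfD[OF S(2) z(5) a'c'(2) z(6)] by blast
      have "x' < z" "z < y'"
        using x'(3) y'(2) z(4,7) by simp_all
      then show ?thesis
        using x' y' z(1) unfolding M_def by blast
    qed
    have "s \<in> M" using MI[of s s s] s S(1) by auto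
    \<comment> \<open>A block taken from \<open>S\<close> between \<open>a'\<close> and
      \<open>c'\<close> has its hull inside \<open>M\<close>; hence \<open>q\<close> is its pivot as
      soon as it has elements on both sides of \<open>q\<close>.\<close>
    define q where "q = arg_min r (\<lambda>z. z \<in> M)"
    have q: "q \<in> M" and q_min: "\<And>z. z \<in> M \<Longrightarrow> r q \<le> r z"
      using \<open>s \<in> M\<close> unfolding q_def by (auto intro: arg_min_natI arg_min_nat_le)
    obtain s1 s2 where s12: "s1 \<in> S" "a' < s1" "s1 < q" "s2 \<in> S" "q < s2" "s2 < c'"
      and qQ: "q \<in> Q"
      using q by (auto simp: M_def)
    \<comment> \<open>The chosen interval is replaced by one on each side of \<open>q\<close>. Since
      \<open>q\<close> need not lie in \<open>S\<close>, the inner endpoints are \<open>s1\<close>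
      and \<open>s2\<close>.\<close>
    define Js where "Js = Us @ [(a', s1), (s2, c')] @ Vs"
    have "w - A < walks l (length Js)"
      using False w by (simp add: C_def Is Js_def less_diff_conv2)
    moreover have "\<forall>(a, c) \<in> set Js. a \<in> S \<and> c \<in> S \<and> a < c"
      using intervals a'c' s12 by (auto simp: Js_def)
    ultimately obtain Ys where Ys: "list_all2 (good_block Q r S (r q)) Js Ys"
      "colour Q r l Ys = w - A" "2 * sum_list (map card Ys) = l + length Js"
      using Suc.IH by blast
    from Ys(1) obtain Xs X1 X2 Zs where XZ: "Ys = Xs @ X1 # X2 # Zs" "length Xs = length Us"
      "list_all2 (good_block Q r S (r q)) Us Xs" "list_all2 (good_block Q r S (r q)) Vs Zs"
      "good_block Q r S (r q) (a', s1) X1" "good_block Q r S (r q) (s2, c') X2"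
      unfolding Js_def by (auto simp: list_all2_append1 list_all2_Cons1)
    have X1: "finite X1" "X1 \<noteq> {}" "\<And>x. x \<in> X1 \<Longrightarrow> x \<in> S \<and> a' < x \<and> x < q \<and> x < c'"
    proof -
      show "finite X1" "X1 \<noteq> {}" using XZ(5) by (auto simp: good_block_def)
      fix x assume "x \<in> X1"
      then have "x \<in> S" "a' < x" "x < s1" using XZ(5) by (auto simp: good_block_def)
      with s12(3,5,6) show "x \<in> S \<and> a' < x \<and> x < q \<and> x < c'" by (metis less_trans)
    qed
    have X2: "finite X2" "X2 \<noteq> {}" "\<And>x. x \<in> X2 \<Longrightarrow> x \<in> S \<and> a' < x \<and> q < x \<and> x < c'"
    proof -
      show "finite X2" "X2 \<noteq> {}" using XZ(6) by (auto simp: good_block_def)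
      fix x assume "x \<in> X2"
      then have "x \<in> S" "x < c'" "s2 < x" using XZ(6) by (auto simp: good_block_def)
      with s12(2,3,5) show "x \<in> S \<and> a' < x \<and> q < x \<and> x < c'" by (metis less_trans)
    qed
    define X where "X = X1 \<union> X2"
    have X: "x \<in> S \<and> a' < x \<and> x < c'" if "x \<in> X" for x
      using that X1(3) X2(3) unfolding X_def by blast
    have split: "{x \<in> X. x < q} = X1" "{x \<in> X. q < x} = X2"
      using X1(3) X2(3) by (auto simp: X_def dest: less_asym)
    have disj: "X1 \<inter> X2 = {}" using X1(3) X2(3) by (auto dest: less_asym)
    have hull_M: "order_hull Q X \<subseteq> M"
      using X MI unfolding order_hull_def by blast
    have "q \<in> order_hull Q X"
      using X1(2,3) X2(2,3) qQ unfolding order_hull_def X_def by (blast intro: less_imp_le)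
    then have pivot: "pivot Q r X = q"
      using hull_M q_min by (intro pivot_eq[OF inj]) auto
    have M_high: "K < r z" if "z \<in> M" for z
      using that high[of z] by (auto simp: M_def intro: less_trans)
    have Kq: "K < r q" using M_high q by blast
    have good: "good_block Q r S K (a, c) X"
      unfolding good_block_def
    proof (intro conjI ballI)
      show "finite X" "X \<noteq> {}" using X1 X2 by (auto simp: X_def)
      show "X \<subseteq> S \<inter> {fst (a, c)<..<snd (a, c)}"
        using X a'c'(3,5) le_less_trans less_le_trans by fastforce
      show "K < r z" if "z \<in> order_hull Q X" for z
        using that M_high hull_M by blast
    qed
    have ne: "X \<noteq> {q}" using X1(2) split(1) by auto
    have first: "first_block Q r (Xs @ X # Zs) = i"
      using good_blocks_pivot[OF XZ(3) S(1)] good_blocks_pivot[OF XZ(4) S(1)]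
        first_block_eq[of Xs Zs r Q "X"] by (auto simp: pivot XZ len)
    have lenXZ: "length (Xs @ X # Zs) = length Is"
      using XZ(2-4) by (auto simp: Is dest: list_all2_lengthD)
    have "colour Q r (Suc l) (Xs @ X # Zs) = i * (A + C) + (A + colour Q r l (Xs @ X1 # X2 # Zs))"
      using XZ(2) len ne unfolding colour.simps first Let_def lenXZ A_def C_def
      by (simp add: nth_append pivot split)
    then have "colour Q r (Suc l) (Xs @ X # Zs) = v"
      using Ys(2) XZ(1) v_eq False by simp
    moreover have "list_all2 (good_block Q r S K) Is (Xs @ X # Zs)"
      unfolding Is using good good_blocks_mono[OF XZ(3)] good_blocks_mono[OF XZ(4)] Kq
      by (intro list_all2_appendI) auto
    moreover have "2 * sum_list (map card (Xs @ X # Zs)) = Suc l + length Is"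
      using Ys(3) card_Un_disjoint[OF X1(1) X2(1) disj] by (simp add: XZ(1) Is Js_def X_def)
    ultimately show ?thesis by blast
  qed
qed

section \<open>Cuts of the sequence space\<close>

definition agree :: "nat \<Rightarrow> (nat \<Rightarrow> nat) \<Rightarrow> (nat \<Rightarrow> nat) \<Rightarrow> bool" where
  "agree n x y \<longleftrightarrow> (\<forall>i<n. x i = y i)"

text \<open>Reading prefixes in base \<open>b\<close> turns the lexicographic comparison of prefixes
  of equal length into comparison of natural numbers.\<close>

primrec prefix_val :: "nat \<Rightarrow> nat \<Rightarrow> (nat \<Rightarrow> nat) \<Rightarrow> nat" where
  "prefix_val b 0 x = 0"
| "prefix_val b (Suc n) x = b * prefix_val b n x + x n"

definition join :: "nat \<Rightarrow> (nat \<Rightarrow> nat) \<Rightarrow> (nat \<Rightarrow> nat) \<Rightarrow> (nat \<Rightarrow> nat)" where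
  "join k s t = (\<lambda>j. if j < k then s j else t (j - k))"

definition shift :: "nat \<Rightarrow> (nat \<Rightarrow> nat) \<Rightarrow> (nat \<Rightarrow> nat)" where
  "shift n x = (\<lambda>j. x (n + j))"

lemma seqsD: "x \<in> seqs b \<Longrightarrow> x n < b"
  by (auto simp: seqs_def dest: funcset_mem)

lemma seqsI: "(\<And>n. x n < b) \<Longrightarrow> x \<in> seqs b"
  by (auto simp: seqs_def)

lemma join_in_seqs: "s \<in> seqs b \<Longrightarrow> t \<in> seqs b \<Longrightarrow> join k s t \<in> seqs b"
  by (auto intro!: seqsI simp: join_def seqsD)

lemma shift_in_seqs: "x \<in> seqs b \<Longrightarrow> shift n x \<in> seqs b"
  by (auto intro!: seqsI simp: shift_def seqsD)

lemma shift_join [simp]: "shift n (join n s t) = t"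
  by (simp add: shift_def join_def)

lemma agree_refl [simp]: "agree n x x"
  by (simp add: agree_def)

lemma agree_mono: "agree n x y \<Longrightarrow> m \<le> n \<Longrightarrow> agree m x y"
  by (simp add: agree_def)

lemma agree_join: "agree k (join k s t) s"
  by (simp add: agree_def join_def)

lemma agree_join_iff: "agree (k + n) (join k s t) (join k s t') \<longleftrightarrow> agree n t t'"
  by (auto simp: agree_def join_def)

lemma agree_shift: "agree (k + n) x y \<Longrightarrow> agree n (shift k x) (shift k y)"
  by (auto simp: agree_def shift_def)

lemma agree_join_self: "agree k x s \<Longrightarrow> join k s (shift k x) = x"
  by (auto simp: agree_def join_def shift_def)

lemma prefix_val_agree: "agree n x y \<Longrightarrow> prefix_val b n x = prefix_val b n y"
  by (induction n) (simp_all add: agree_def)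

lemma prefix_val_less: "x \<in> seqs b \<Longrightarrow> prefix_val b n x < b ^ n"
proof (induction n)
  case (Suc n)
  have "b * prefix_val b n x + x n < b * prefix_val b n x + b"
    using seqsD[OF Suc.prems] by simp
  also have "\<dots> = b * Suc (prefix_val b n x)" by simp
  also have "\<dots> \<le> b * b ^ n"
    using Suc by (intro mult_left_mono) auto
  finally show ?case by simp
qed simp

lemma digit_expansion_less_iff:
  fixes d e :: nat
  assumes "d < b" "e < b"
  shows "b * m + d < b * n + e \<longleftrightarrow> m < n \<or> m = n \<and> d < e"
proof (cases m n rule: linorder_cases)
  case less
  then have "b * Suc m \<le> b * n" by (intro mult_left_mono) auto
  then show ?thesis using assms less by simp
next
  case greater
  then have "b * Suc n \<le> b * m" by (intro mult_left_mono) auto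
  then show ?thesis using assms greater by simp
qed simp

lemma prefix_val_less_mono:
  assumes "x \<in> seqs b" "y \<in> seqs b" "m \<le> n" "prefix_val b m x < prefix_val b m y"
  shows "prefix_val b n x < prefix_val b n y"
  using assms(3)
proof (induction n rule: dec_induct)
  case base
  show ?case by (rule assms)
next
  case (step n)
  then show ?case
    by (simp add: digit_expansion_less_iff[OF seqsD[OF assms(1)] seqsD[OF assms(2)]])
qed

lemma agree_iff_prefix_val:
  assumes "x \<in> seqs b" "y \<in> seqs b"
  shows "agree n x y \<longleftrightarrow> prefix_val b n x = prefix_val b n y"
proof (induction n)
  case (Suc n)
  have "agree (Suc n) x y \<longleftrightarrow> agree n x y \<and> x n = y n"
    by (auto simp: agree_def less_Suc_eq)
  also have "\<dots> \<longleftrightarrow> prefix_val b (Suc n) x = prefix_val b (Suc n) y"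
    using digit_expansion_less_iff[OF seqsD[OF assms(1)] seqsD[OF assms(2)]]
      digit_expansion_less_iff[OF seqsD[OF assms(2)] seqsD[OF assms(1)]]
    by (simp add: Suc) (metis nat_neq_iff)
  finally show ?case .
qed (simp add: agree_def)

lemma agree_first_diff:
  assumes "x \<noteq> y"
  shows "x (first_diff x y) \<noteq> y (first_diff x y)" "agree n x y \<longleftrightarrow> n \<le> first_diff x y"
proof -
  obtain m where "x m \<noteq> y m" using assms by auto
  then show *: "x (first_diff x y) \<noteq> y (first_diff x y)"
    unfolding first_diff_def by (rule LeastI)
  have "x i = y i" if "i < first_diff x y" for i
    using not_less_Least[of i "\<lambda>n. x n \<noteq> y n"] that by (auto simp: first_diff_def)
  then show "agree n x y \<longleftrightarrow> n \<le> first_diff x y"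
    using * by (auto simp: agree_def not_le[symmetric])
qed

text \<open>The values agree up to the first difference, separate at the next length as the digits
  do, and keep that order by \<open>prefix_val_less_mono\<close>.\<close>

lemma lex_le_iff:
  assumes "x \<in> seqs b" "y \<in> seqs b"
  shows "lex_le x y \<longleftrightarrow> (\<forall>n. prefix_val b n x \<le> prefix_val b n y)"
proof (cases "x = y")
  case False
  let ?d = "first_diff x y"
  note d = agree_first_diff[OF False]
  have eq: "prefix_val b n x = prefix_val b n y" if "n \<le> ?d" for n
    using d(2) that by (intro prefix_val_agree) simp
  have less: "prefix_val b (Suc ?d) x < prefix_val b (Suc ?d) y \<longleftrightarrow> x ?d < y ?d"
    by (simp add: eq)
  show ?thesis
  proof
    assume "lex_le x y"
    then have *: "prefix_val b (Suc ?d) x < prefix_val b (Suc ?d) y"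
      using False less by (simp add: lex_le_def)
    show "\<forall>n. prefix_val b n x \<le> prefix_val b n y"
    proof
      fix n
      show "prefix_val b n x \<le> prefix_val b n y"
      proof (cases "n \<le> ?d")
        case True
        then show ?thesis by (simp add: eq)
      next
        case False
        then have "Suc ?d \<le> n" by simp
        then show ?thesis
          using prefix_val_less_mono[OF assms _ *] by (simp add: less_imp_le)
      qed
    qed
  next
    assume "\<forall>n. prefix_val b n x \<le> prefix_val b n y"
    then have "prefix_val b (Suc ?d) x \<le> prefix_val b (Suc ?d) y" by blast
    then have "x ?d \<le> y ?d" by (simp add: eq)
    then show "lex_le x y"
      using d(1) by (simp add: lex_le_def)
  qed
qed (simp add: lex_le_def)

lemma lex_leI:
  assumes "x \<in> seqs b" "y \<in> seqs b" "prefix_val b n x < prefix_val b n y"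
  shows "lex_le x y"
  unfolding lex_le_iff[OF assms(1,2)]
proof
  fix m
  have "\<not> prefix_val b m y < prefix_val b m x" if "m \<le> n"
    using prefix_val_less_mono[OF assms(2,1) that] assms(3) by auto
  moreover have "prefix_val b m x < prefix_val b m y" if "n \<le> m"
    by (rule prefix_val_less_mono[OF assms(1,2) that assms(3)])
  ultimately show "prefix_val b m x \<le> prefix_val b m y"
    by (meson less_imp_le linorder_linear not_le)
qed

lemma prefix_val_join:
  "prefix_val b (k + n) (join k s t) = prefix_val b k s * b ^ n + prefix_val b n t"
proof (induction n)
  case 0
  show ?case using prefix_val_agree[OF agree_join] by simp
next
  case (Suc n)
  have "join k s t (k + n) = t n" by (simp add: join_def)
  then show ?case by (simp add: Suc algebra_simps)
qed

lemma prefix_val_add: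
  "prefix_val b (k + n) x = prefix_val b k x * b ^ n + prefix_val b n (shift k x)"
  using prefix_val_join[of b k n x "shift k x"] by (simp add: agree_join_self)

lemma prefix_val_surj:
  assumes "v < b ^ n" "0 < b"
  shows "\<exists>x\<in>seqs b. prefix_val b n x = v"
  using assms(1)
proof (induction n arbitrary: v)
  case 0
  have "(\<lambda>_. 0) \<in> seqs b" using assms(2) by (intro seqsI)
  then show ?case using 0 by auto
next
  case (Suc n)
  have "v div b < b ^ n"
    using Suc.prems by (simp add: less_mult_imp_div_less mult.commute)
  then obtain x where x: "x \<in> seqs b" "prefix_val b n x = v div b"
    using Suc.IH by blast
  have "prefix_val b n (x(n := v mod b)) = prefix_val b n x"
    by (intro prefix_val_agree) (simp add: agree_def)
  then have "prefix_val b (Suc n) (x(n := v mod b)) = v"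
    by (simp add: x)
  moreover have "x(n := v mod b) \<in> seqs b"
    using x(1) assms(2) by (auto intro!: seqsI simp: seqsD)
  ultimately show ?case by blast
qed

section \<open>The order of the cuts\<close>

definition cut :: "nat \<Rightarrow> nat \<Rightarrow> nat \<Rightarrow> (nat \<Rightarrow> nat) set" where
  "cut b n v = {x \<in> seqs b. prefix_val b n x < v}"

text \<open>The bounds on \<open>v\<close> exclude the empty set and the whole space.\<close>

definition cuts :: "nat \<Rightarrow> (nat \<Rightarrow> nat) set set" where
  "cuts b = {cut b n v | n v. 0 < v \<and> v < b ^ n}"

lemma cut_in_cuts: "0 < v \<Longrightarrow> v < b ^ n \<Longrightarrow> cut b n v \<in> cuts b"
  by (auto simp: cuts_def)

lemma countable_cuts: "countable (cuts b)"
proof -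
  have "cuts b \<subseteq> range (\<lambda>(n, v). cut b n v)" by (auto simp: cuts_def)
  then show ?thesis by (rule countable_subset) simp
qed

lemma cuts_subset_seqs: "D \<in> cuts b \<Longrightarrow> D \<subseteq> seqs b"
  by (auto simp: cuts_def cut_def)

lemma cut_less_iff:
  assumes "0 < b" "v \<le> b ^ n" "v' \<le> b ^ n"
  shows "cut b n v \<subset> cut b n v' \<longleftrightarrow> v < v'"
proof
  assume "v < v'"
  then obtain x where "x \<in> seqs b" "prefix_val b n x = v"
    using prefix_val_surj[of v b n] assms by auto
  with \<open>v < v'\<close> have "x \<in> cut b n v' - cut b n v" by (simp add: cut_def)
  moreover have "cut b n v \<subseteq> cut b n v'"
    using \<open>v < v'\<close> by (auto simp: cut_def)
  ultimately show "cut b n v \<subset> cut b n v'" by blast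
next
  assume *: "cut b n v \<subset> cut b n v'"
  show "v < v'"
  proof (rule ccontr)
    assume "\<not> v < v'"
    then have "cut b n v' \<subseteq> cut b n v" by (auto simp: cut_def)
    with * show False by blast
  qed
qed

text \<open>The next \<open>k\<close> digits contribute less than \<open>b ^ k\<close>, so the
  threshold only has to be scaled.\<close>

lemma cut_refine:
  assumes "0 < b"
  shows "cut b (n + k) (v * b ^ k) = cut b n v"
proof -
  have "prefix_val b (n + k) x < v * b ^ k \<longleftrightarrow> prefix_val b n x < v" if "x \<in> seqs b" for x
  proof
    assume "prefix_val b n x < v"
    then have "Suc (prefix_val b n x) * b ^ k \<le> v * b ^ k" by (intro mult_right_mono) auto
    then show "prefix_val b (n + k) x < v * b ^ k"
      using prefix_val_less[OF shift_in_seqs[OF that], of k n] by (simp add: prefix_val_add)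
  next
    assume "prefix_val b (n + k) x < v * b ^ k"
    then have "prefix_val b n x * b ^ k < v * b ^ k"
      unfolding prefix_val_add by (rule le_less_trans[OF le_add1])
    then show "prefix_val b n x < v" by simp
  qed
  then show ?thesis by (auto simp: cut_def)
qed

text \<open>Bringing finitely many cuts to one level reduces questions about them to finite sets of
  numbers.\<close>

lemma cuts_common_level:
  assumes "finite Y" "Y \<subseteq> cuts b" "0 < b"
  shows "\<exists>n Vs. Vs \<subseteq> {0<..<b ^ n} \<and> Y = cut b n ` Vs"
  using assms(1,2)
proof (induction Y)
  case empty
  then show ?case by blast
next
  case (insert D Y)
  then obtain n Vs where Vs: "Vs \<subseteq> {0<..<b ^ n}" "Y = cut b n ` Vs" by auto
  obtain m v where v: "D = cut b m v" "0 < v" "v < b ^ m"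
    using insert.prems by (auto simp: cuts_def)
  let ?Vs = "insert (v * b ^ n) ((\<lambda>v. v * b ^ m) ` Vs)"
  have "cut b (m + n) (v * b ^ n) = D" "\<And>v. cut b (m + n) (v * b ^ m) = cut b n v"
    using cut_refine[OF assms(3), of m n] cut_refine[OF assms(3), of n m] v
    by (simp_all add: add.commute)
  then have "insert D Y = cut b (m + n) ` ?Vs"
    by (simp add: Vs(2) image_image)
  moreover have "?Vs \<subseteq> {0<..<b ^ (m + n)}"
    using Vs(1) v assms(3) by (auto simp: power_add mult.commute)
  ultimately show ?case by blast
qed

lemma dense_in_itself_cuts:
  assumes "2 \<le> b"
  shows "dense_in_itself (cuts b)"
  unfolding dense_in_itself_def
proof (intro ballI impI)
  fix D D' assume D: "D \<in> cuts b" "D' \<in> cuts b" "D < D'"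
  have "0 < b" using assms by simp
  obtain n Vs where Vs: "Vs \<subseteq> {0<..<b ^ n}" "{D, D'} = cut b n ` Vs"
    using cuts_common_level[of "{D, D'}" b] D assms by auto
  then obtain v v' where v: "D = cut b n v" "v \<in> Vs" "D' = cut b n v'" "v' \<in> Vs"
    by (metis imageE insertI1 insertI2)
  then have bounds: "v < b ^ n" "v' < b ^ n" using Vs(1) by auto
  then have "v < v'" using D(3) cut_less_iff[OF \<open>0 < b\<close>] v by simp
  then have "Suc v * b \<le> v' * b" by (intro mult_right_mono) auto
  \<comment> \<open>One more digit makes room: as \<open>b\<close> is at least 2,
    \<open>v * b + 1\<close> lies below \<open>Suc v * b\<close>.\<close>
  then have between: "v * b < v * b + 1" "v * b + 1 < v' * b" using assms by auto
  have le: "v' * b < b ^ (n + 1)" using \<open>0 < b\<close> bounds by simp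
  have "D = cut b (n + 1) (v * b)" "D' = cut b (n + 1) (v' * b)"
    using cut_refine[OF \<open>0 < b\<close>, of n 1] v by simp_all
  then have "D < cut b (n + 1) (v * b + 1)" "cut b (n + 1) (v * b + 1) < D'"
    using between le by (simp_all only:) (subst cut_less_iff[OF \<open>0 < b\<close>]; linarith)+
  moreover have "cut b (n + 1) (v * b + 1) \<in> cuts b"
    by (rule cut_in_cuts) (use between le in linarith)+
  ultimately show "\<exists>s\<in>cuts b. D < s \<and> s < D'" by blast
qed

text \<open>The level in \<open>clopen\<close> depends on the point; a compactness argument along a
  single branch makes it uniform, and then prefixes of one length decide membership in
  \<open>D\<close>.\<close>

lemma cutsI:
  assumes "D \<subseteq> seqs b" "D \<noteq> {}" "D \<noteq> seqs b"
    and initial: "\<And>x y. x \<in> seqs b \<Longrightarrow> y \<in> D \<Longrightarrow> lex_le x y \<Longrightarrow> x \<in> D"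
    and clopen: "\<And>x. x \<in> seqs b \<Longrightarrow> \<exists>n. \<forall>y\<in>seqs b. agree n x y \<longrightarrow> (y \<in> D \<longleftrightarrow> x \<in> D)"
  shows "D \<in> cuts b"
proof -
  have "\<exists>n. \<forall>x\<in>D. \<forall>y\<in>seqs b. agree n x y \<longrightarrow> y \<in> D"
  proof (rule ccontr)
    assume "\<nexists>n. \<forall>x\<in>D. \<forall>y\<in>seqs b. agree n x y \<longrightarrow> y \<in> D"
    then obtain X Y where XY: "X n \<in> D" "Y n \<in> seqs b" "Y n \<notin> D" "agree n (X n) (Y n)" for n
      by metis
    have X: "X n \<in> seqs b" for n using XY(1) assms(1) by blast
    text \<open>By monotonicity at most one prefix of each length is shared by \<open>D\<close> and its
      complement, so these prefixes are coherent and define a boundary point.\<close>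
    have coherent: "agree n (X n) (X m)" if "n \<le> m" for n m
    proof -
      have nm: "agree n (X m) (Y m)" using XY(4) that by (rule agree_mono)
      have "prefix_val b n (X n) = prefix_val b n (Y n)" "prefix_val b n (X m) = prefix_val b n (Y m)"
        using XY(4) nm by (simp_all add: prefix_val_agree)
      moreover have "\<not> prefix_val b n (Y n) < prefix_val b n (X m)"
        using initial[OF XY(2) XY(1) lex_leI[OF XY(2) X]] XY(3) by blast
      moreover have "\<not> prefix_val b n (Y m) < prefix_val b n (X n)"
        using initial[OF XY(2) XY(1) lex_leI[OF XY(2) X]] XY(3) by blast
      ultimately show ?thesis
        using agree_iff_prefix_val[OF X X] by simp
    qed
    define z where "z = (\<lambda>n. X (Suc n) n)"
    have z: "z \<in> seqs b" unfolding z_def by (rule seqsI) (rule seqsD[OF X])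
    have zX: "agree n z (X n)" for n
      unfolding agree_def
    proof (intro allI impI)
      fix i assume "i < n"
      then have "agree (Suc i) (X (Suc i)) (X n)" by (intro coherent) simp
      then show "z i = X n i" by (simp add: z_def agree_def)
    qed
    obtain n where n: "\<And>y. y \<in> seqs b \<Longrightarrow> agree n z y \<Longrightarrow> y \<in> D \<longleftrightarrow> z \<in> D"
      using clopen[OF z] by blast
    have "agree n z (Y n)" using zX[of n] XY(4)[of n] by (simp add: agree_def)
    then show False
      using n[OF X zX] n[OF XY(2)] XY(1,3) by blast
  qed
  then obtain n where n: "\<And>x y. x \<in> D \<Longrightarrow> y \<in> seqs b \<Longrightarrow> agree n x y \<Longrightarrow> y \<in> D"
    by blast
  \<comment> \<open>The threshold is the least prefix value outside \<open>D\<close>: smaller values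
    lie in \<open>D\<close> by minimality, larger ones do not since \<open>D\<close> is initial, and
    the uniform \<open>n\<close> settles the value itself.\<close>
  define v where "v = (LEAST v. v \<in> prefix_val b n ` (seqs b - D))"
  have "seqs b - D \<noteq> {}" using assms(1,3) by blast
  then have "\<exists>v. v \<in> prefix_val b n ` (seqs b - D)" by blast
  then have "v \<in> prefix_val b n ` (seqs b - D)"
    unfolding v_def by (rule LeastI_ex)
  then obtain y where y: "y \<in> seqs b" "y \<notin> D" "v = prefix_val b n y" by blast
  have "x \<in> D \<longleftrightarrow> prefix_val b n x < v" if x: "x \<in> seqs b" for x
  proof
    assume "prefix_val b n x < v"
    then have "prefix_val b n x \<notin> prefix_val b n ` (seqs b - D)"
      unfolding v_def by (rule not_less_Least)
    then show "x \<in> D" using x by blast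
  next
    assume "x \<in> D"
    then have "\<not> prefix_val b n y < prefix_val b n x" "prefix_val b n x \<noteq> prefix_val b n y"
      using y n[of x y] initial[OF y(1) _ lex_leI[OF y(1) x]] agree_iff_prefix_val[OF x y(1)] by blast+
    then show "prefix_val b n x < v" using y(3) by simp
  qed
  then have D: "D = cut b n v" using assms(1) by (auto simp: cut_def)
  moreover have "0 < v" using assms(2) D by (auto simp: cut_def)
  moreover have "v < b ^ n" using y prefix_val_less by blast
  ultimately show ?thesis unfolding cuts_def by blast
qed

section \<open>Continuity in terms of digits, and preimages of cuts\<close>

lemma seq_dist_less_iff: "seq_dist x y < 1 / 2 ^ n \<longleftrightarrow> agree (Suc n) x y"
proof (cases "x = y")
  case False
  have "seq_dist x y < 1 / 2 ^ n \<longleftrightarrow> (2::real) ^ n < 2 ^ first_diff x y"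
    using False by (simp add: seq_dist_def field_simps)
  also have "\<dots> \<longleftrightarrow> agree (Suc n) x y"
    using agree_first_diff(2)[OF False] by (simp add: Suc_le_eq)
  finally show ?thesis .
qed (simp add: seq_dist_def)

text \<open>Radii \<open>1 / 2 ^ n\<close> suffice in the epsilon-delta condition, and for them
  balls are sets of sequences with a common prefix.\<close>

lemma C_sur_iff:
  "f \<in> C_sur b \<longleftrightarrow> f \<in> extensional (seqs b) \<and> f ` seqs b = seqs b \<and>
     monotone_on (seqs b) lex_le lex_le f \<and>
     (\<forall>x\<in>seqs b. \<forall>N. \<exists>M. \<forall>y\<in>seqs b. agree M x y \<longrightarrow> agree N (f x) (f y))"
proof -
  interpret M: Metric_space "seqs b" seq_dist by (rule Metric_space_seqs)
  have small: "\<exists>n. 1 / 2 ^ n < e" if "0 < e" for e :: real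
    using real_arch_pow_inv[OF that, of "1 / 2"] by (simp add: power_one_over)
  have "(\<forall>a\<in>seqs b. \<forall>e>0. \<exists>d>0. \<forall>x. x \<in> seqs b \<and> seq_dist a x < d \<longrightarrow> seq_dist (f a) (f x) < e)
      \<longleftrightarrow> (\<forall>x\<in>seqs b. \<forall>N. \<exists>M. \<forall>y\<in>seqs b. agree M x y \<longrightarrow> agree N (f x) (f y))" (is "?l \<longleftrightarrow> ?r")
  proof
    assume l: ?l
    show ?r
    proof (intro ballI allI)
      fix x N assume x: "x \<in> seqs b"
      obtain d where d: "d > 0"
        "\<And>y. y \<in> seqs b \<Longrightarrow> seq_dist x y < d \<Longrightarrow> seq_dist (f x) (f y) < 1 / 2 ^ N"
        using l[rule_format, OF x, of "1 / 2 ^ N"] by auto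
      obtain n where n: "1 / 2 ^ n < d" using small[OF d(1)] by blast
      have "agree N (f x) (f y)" if "y \<in> seqs b" "agree (Suc n) x y" for y
      proof -
        have "seq_dist x y < d" using that(2) n seq_dist_less_iff less_trans by blast
        then have "agree (Suc N) (f x) (f y)" using d(2) that(1) seq_dist_less_iff by blast
        then show ?thesis by (rule agree_mono) simp
      qed
      then show "\<exists>M. \<forall>y\<in>seqs b. agree M x y \<longrightarrow> agree N (f x) (f y)" by blast
    qed
  next
    assume r: ?r
    show ?l
    proof (intro ballI allI impI)
      fix x and e :: real assume x: "x \<in> seqs b" and "e > 0"
      then obtain n where n: "1 / 2 ^ n < e" using small by blast
      obtain M where M: "\<And>y. y \<in> seqs b \<Longrightarrow> agree M x y \<Longrightarrow> agree (Suc n) (f x) (f y)"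
        using r x by blast
      have "seq_dist (f x) (f y) < e" if "y \<in> seqs b" "seq_dist x y < 1 / 2 ^ M" for y
      proof -
        have "agree M x y"
          using that(2) by (simp add: seq_dist_less_iff agree_mono[of "Suc M"])
        then have "seq_dist (f x) (f y) < 1 / 2 ^ n"
          using M that(1) by (simp add: seq_dist_less_iff)
        then show ?thesis using n by simp
      qed
      then show "\<exists>d>0. \<forall>y. y \<in> seqs b \<and> seq_dist x y < d \<longrightarrow> seq_dist (f x) (f y) < e"
        by (intro exI[of _ "1 / 2 ^ M"]) simp
    qed
  qed
  then show ?thesis
    unfolding C_sur_def mem_Collect_eq M.metric_continuous_map[OF Metric_space_seqs] by auto
qed

definition pullback :: "nat \<Rightarrow> ((nat \<Rightarrow> nat) \<Rightarrow> (nat \<Rightarrow> nat)) \<Rightarrow> (nat \<Rightarrow> nat) set \<Rightarrow> (nat \<Rightarrow> nat) set"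
  where "pullback b h D = {x \<in> seqs b. h x \<in> D}"

lemma C_sur_image: "h \<in> C_sur b \<Longrightarrow> h ` seqs b = seqs b"
  by (simp add: C_sur_iff)

lemma C_sur_in_seqs: "h \<in> C_sur b \<Longrightarrow> x \<in> seqs b \<Longrightarrow> h x \<in> seqs b"
  using C_sur_image by blast

text \<open>Surjectivity of \<open>h\<close> makes preimages reflect inclusion; hence
  \<open>pullback b h\<close> embeds the order of the cuts.\<close>

lemma pullback_subset_iff:
  assumes "h \<in> C_sur b" "D \<subseteq> seqs b"
  shows "pullback b h D \<subseteq> pullback b h D' \<longleftrightarrow> D \<subseteq> D'"
proof
  assume *: "pullback b h D \<subseteq> pullback b h D'"
  show "D \<subseteq> D'"
  proof
    fix z assume "z \<in> D"
    then obtain x where "x \<in> seqs b" "z = h x"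
      using assms(2) C_sur_image[OF assms(1)] by (metis imageE subsetD)
    with * \<open>z \<in> D\<close> show "z \<in> D'" by (auto simp: pullback_def)
  qed
qed (auto simp: pullback_def)

lemma inj_on_pullback: "h \<in> C_sur b \<Longrightarrow> inj_on (pullback b h) (cuts b)"
  by (rule inj_onI, rule subset_antisym)
    (simp_all add: cuts_subset_seqs flip: pullback_subset_iff[of h b])

lemma pullback_less_iff:
  "h \<in> C_sur b \<Longrightarrow> D \<in> cuts b \<Longrightarrow> D' \<in> cuts b \<Longrightarrow> pullback b h D < pullback b h D' \<longleftrightarrow> D < D'"
  by (simp add: less_le_not_le pullback_subset_iff cuts_subset_seqs)

text \<open>By \<open>cutsI\<close>: monotonicity of \<open>h\<close> gives an initial segment,
  continuity a clopen one, and surjectivity keeps it nonempty and proper.\<close>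

lemma pullback_in_cuts:
  assumes "h \<in> C_sur b" "D \<in> cuts b" "0 < b"
  shows "pullback b h D \<in> cuts b"
proof (rule cutsI)
  obtain n v where D: "D = cut b n v" "0 < v" "v < b ^ n"
    using assms(2) by (auto simp: cuts_def)
  show "pullback b h D \<subseteq> seqs b" by (auto simp: pullback_def)
  have ne: "cut b n 0 \<subset> D" "D \<subset> cut b n (b ^ n)"
    unfolding D(1) using D(2,3) by (simp_all add: cut_less_iff[OF assms(3)])
  then have "\<exists>x\<in>seqs b. x \<in> D" "\<exists>x\<in>seqs b. x \<notin> D"
    using cuts_subset_seqs[OF assms(2)] by (auto simp: cut_def)
  then show "pullback b h D \<noteq> {}" "pullback b h D \<noteq> seqs b"
    unfolding pullback_def by (metis (mono_tags, lifting) C_sur_image[OF assms(1)] empty_iff imageE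
      mem_Collect_eq)+
next
  obtain n v where D: "D = cut b n v"
    using assms(2) by (auto simp: cuts_def)
  note h = C_sur_in_seqs[OF assms(1)]
  fix x
  assume x: "x \<in> seqs b"
  show "x \<in> pullback b h D" if y: "y \<in> pullback b h D" and le: "lex_le x y" for y
  proof -
    have "y \<in> seqs b" using y by (simp add: pullback_def)
    then have "lex_le (h x) (h y)"
      using assms(1) x le by (auto simp: C_sur_iff monotone_on_def)
    then have "prefix_val b n (h x) \<le> prefix_val b n (h y)"
      using lex_le_iff[OF h h] x \<open>y \<in> seqs b\<close> by blast
    then show ?thesis
      using y x h by (auto simp: pullback_def D cut_def)
  qed
  obtain M where M: "\<And>y. y \<in> seqs b \<Longrightarrow> agree M x y \<Longrightarrow> agree n (h x) (h y)"
    using assms(1) x unfolding C_sur_iff by blast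
  have "y \<in> pullback b h D \<longleftrightarrow> x \<in> pullback b h D" if "y \<in> seqs b" "agree M x y" for y
    using prefix_val_agree[OF M[OF that], of b] that x h by (simp add: pullback_def D cut_def)
  then show "\<exists>M. \<forall>y\<in>seqs b. agree M x y \<longrightarrow> (y \<in> pullback b h D \<longleftrightarrow> x \<in> pullback b h D)"
    by blast
qed

section \<open>Maps with prescribed preimages of cuts\<close>

lemma card_below_less:
  fixes V :: "'a::linorder set"
  assumes "finite V" "w < w'" "w' \<in> V"
  shows "card {v \<in> V. v \<le> w} < card {v \<in> V. v \<le> w'}"
proof (rule psubset_card_mono)
  have "w' \<in> {v \<in> V. v \<le> w'}" "w' \<notin> {v \<in> V. v \<le> w}" using assms by auto
  moreover have "{v \<in> V. v \<le> w} \<subseteq> {v \<in> V. v \<le> w'}" using assms(2) by auto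
  ultimately show "{v \<in> V. v \<le> w} \<subset> {v \<in> V. v \<le> w'}" by blast
qed (use assms(1) in simp)

text \<open>The counting function is injective on \<open>insert 0 V\<close>, which has as many
  elements as \<open>{..card V}\<close>.\<close>

lemma card_below_surj:
  fixes V :: "nat set"
  assumes "finite V" "0 \<notin> V" "i \<le> card V"
  shows "\<exists>w\<in>insert 0 V. card {v \<in> V. v \<le> w} = i"
proof -
  let ?c = "\<lambda>w. card {v \<in> V. v \<le> w}"
  have "inj_on ?c (insert 0 V)"
  proof (rule linorder_inj_onI')
    fix w w' assume "w \<in> insert 0 V" "w' \<in> insert 0 V" "w < w'"
    then have "?c w < ?c w'" using assms(1) by (intro card_below_less) auto
    then show "?c w \<noteq> ?c w'" by simp
  qed
  then have "card (?c ` insert 0 V) = card {..card V}"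
    using assms(1,2) by (simp add: card_image)
  moreover have "?c ` insert 0 V \<subseteq> {..card V}"
    using assms(1) by (auto intro!: card_mono)
  ultimately have "?c ` insert 0 V = {..card V}"
    by (intro card_subset_eq) auto
  then show ?thesis using assms(3) by (metis (no_types, lifting) atMost_iff imageE)
qed

text \<open>At a common level \<open>n\<close> the thresholds \<open>V\<close> divide the
  \<open>b ^ n\<close> prefixes into \<open>b ^ k\<close> intervals with left ends
  \<open>insert 0 V\<close>; \<open>f\<close> maps the cones of each interval onto the
  level-\<open>k\<close> cone of the same index.\<close>

lemma cuts_realised:
  assumes b: "2 \<le> b" and Y: "finite Y" "Y \<subseteq> cuts b" "Suc (card Y) = b ^ k"
  shows "\<exists>f\<in>C_sur b. (\<lambda>i. pullback b f (cut b k i)) ` {0<..<b ^ k} = Y"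
proof -
  have "0 < b" using b by simp
  obtain n V where V: "V \<subseteq> {0<..<b ^ n}" "Y = cut b n ` V"
    using cuts_common_level[OF Y(1,2) \<open>0 < b\<close>] by blast
  have "finite V" using V(1) by (rule finite_subset) simp
  have "inj_on (cut b n) V"
  proof (rule linorder_inj_onI')
    fix v v' assume "v \<in> V" "v' \<in> V" "v < v'"
    then have "cut b n v \<subset> cut b n v'"
      using V(1) by (subst cut_less_iff[OF \<open>0 < b\<close>]) auto
    then show "cut b n v \<noteq> cut b n v'" by blast
  qed
  then have card_V: "Suc (card V) = b ^ k" using Y(3) by (simp add: V(2) card_image)
  \<comment> \<open>\<open>u w\<close> is the index of the interval containing \<open>w\<close>; it
    increases exactly at the elements of \<open>V\<close>.\<close>
  define u where "u w = card {v \<in> V. v \<le> w}" for w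
  have u_less: "u w < b ^ k" for w
    using card_mono[OF \<open>finite V\<close>, of "{v \<in> V. v \<le> w}"] card_V by (simp add: u_def)
  have u_mono: "u w \<le> u w'" if "w \<le> w'" for w w'
    using that \<open>finite V\<close> unfolding u_def by (intro card_mono) auto
  have u_strict: "u w < u w'" if "w < w'" "w' \<in> V" for w w'
    unfolding u_def using \<open>finite V\<close> that by (rule card_below_less)
  have u_surj: "\<exists>w\<in>insert 0 V. u w = i" if "i < b ^ k" for i
    using card_below_surj[OF \<open>finite V\<close>, of i] V(1) that card_V unfolding u_def by force
  obtain s where s: "\<And>i. i < b ^ k \<Longrightarrow> s i \<in> seqs b" "\<And>i. i < b ^ k \<Longrightarrow> prefix_val b k (s i) = i"
    using prefix_val_surj[OF _ \<open>0 < b\<close>, of _ k] by metis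
  define top where "top = (\<lambda>_::nat. b - 1)"
  have top: "top \<in> seqs b" using b by (auto simp: top_def intro: seqsI)
  have le_top: "prefix_val b m x \<le> prefix_val b m top" if "x \<in> seqs b" for x m
  proof (induction m)
    case (Suc m)
    have "x m \<le> top m" using seqsD[OF that, of m] by (simp add: top_def)
    with Suc show ?case by (simp add: add_mono)
  qed simp
  text \<open>On each block of level-\<open>n\<close> cones the whole of \<open>b\<^sup>\<omega>\<close> is already covered by the
    first cone, and the other cones are collapsed to the maximum of the target cone.\<close>
  define tail where
    "tail x = (if prefix_val b n x \<in> insert 0 V then shift n x else top)" for x
  define f where
    "f = restrict (\<lambda>x. join k (s (u (prefix_val b n x))) (tail x)) (seqs b)"
  have tail: "tail x \<in> seqs b" if "x \<in> seqs b" for x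
    using that top by (simp add: tail_def shift_in_seqs)
  have f: "f x = join k (s (u (prefix_val b n x))) (tail x)" if "x \<in> seqs b" for x
    using that by (simp add: f_def)
  have f_seqs: "f x \<in> seqs b" if "x \<in> seqs b" for x
    using that by (simp add: f join_in_seqs s u_less tail)
  have f_add: "prefix_val b (k + m) (f x) =
      u (prefix_val b n x) * b ^ m + prefix_val b m (tail x)" if "x \<in> seqs b" for x m
    using that by (simp add: f prefix_val_join s u_less)
  have f_k: "prefix_val b k (f x) = u (prefix_val b n x)" if "x \<in> seqs b" for x
    using f_add[OF that, of 0] by simp
  have "f ` seqs b = seqs b"
  proof
    show "seqs b \<subseteq> f ` seqs b"
    proof
      fix y assume y: "y \<in> seqs b"
      obtain w where w: "w \<in> insert 0 V" "u w = prefix_val b k y"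
        using u_surj[OF prefix_val_less[OF y]] by blast
      have "w < b ^ n" using w(1) V(1) \<open>0 < b\<close> by auto
      then obtain p where p: "p \<in> seqs b" "prefix_val b n p = w"
        using prefix_val_surj \<open>0 < b\<close> by blast
      define x where "x = join n p (shift k y)"
      have x: "x \<in> seqs b" using p y by (simp add: x_def join_in_seqs shift_in_seqs)
      have xw: "prefix_val b n x = w"
        using prefix_val_agree[OF agree_join] p by (simp add: x_def)
      then have "tail x = shift k y" using w(1) by (simp add: tail_def x_def)
      moreover have "agree k y (s (u w))"
        using y w(2) s prefix_val_less[OF y] by (simp add: agree_iff_prefix_val[of _ b])
      ultimately have "f x = y" by (simp add: f x xw agree_join_self)
      then show "y \<in> f ` seqs b" using x by blast
    qed
  qed (use f_seqs in auto)
  moreover have "monotone_on (seqs b) lex_le lex_le f"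
  proof (rule monotone_onI)
    fix x y assume x: "x \<in> seqs b" and y: "y \<in> seqs b" and xy: "lex_le x y"
    then have le: "prefix_val b m x \<le> prefix_val b m y" for m
      using lex_le_iff[OF x y] by blast
    have tails: "lex_le (f x) (f y)" if eq: "u (prefix_val b n x) = u (prefix_val b n y)"
      and t: "\<And>m. prefix_val b m (tail x) \<le> prefix_val b m (tail y)"
    proof -
      have "prefix_val b m (f x) \<le> prefix_val b m (f y)" for m
      proof (cases "m \<le> k")
        case True
        have "agree k (f x) (f y)" using eq f_k x y by (simp add: agree_iff_prefix_val[of _ b] f_seqs)
        then show ?thesis using True agree_mono prefix_val_agree by (metis order_refl)
      next
        case False
        then obtain m' where "m = k + m'" by (metis le_Suc_ex nat_le_linear)
        then show ?thesis using f_add x y eq t by simp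
      qed
      then show ?thesis using lex_le_iff[OF f_seqs[OF x] f_seqs[OF y]] by blast
    qed
    show "lex_le (f x) (f y)"
    proof (cases "prefix_val b n x = prefix_val b n y")
      case True
      show ?thesis
      proof (rule tails)
        fix m
        have "prefix_val b m (shift n x) \<le> prefix_val b m (shift n y)"
          using le[of "n + m"] True by (simp add: prefix_val_add)
        then show "prefix_val b m (tail x) \<le> prefix_val b m (tail y)"
          using True by (simp add: tail_def)
      qed (use True in simp)
    next
      case False
      then have less: "prefix_val b n x < prefix_val b n y" using le[of n] by simp
      show ?thesis
      proof (cases "u (prefix_val b n x) = u (prefix_val b n y)")
        case True
        \<comment> \<open>A larger prefix in the same interval is not its left end, so the cone of
          \<open>y\<close> is a collapsed one.\<close>
        then have "prefix_val b n y \<notin> insert 0 V" using u_strict[OF less] less by auto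
        then have "tail y = top" by (simp add: tail_def)
        then show ?thesis using tails[OF True] le_top tail[OF x] by simp
      next
        case False
        then have "prefix_val b k (f x) < prefix_val b k (f y)"
          using u_mono[OF less_imp_le[OF less]] f_k x y by simp
        then show ?thesis by (rule lex_leI[OF f_seqs[OF x] f_seqs[OF y]])
      qed
    qed
  qed
  moreover have "\<exists>M. \<forall>y\<in>seqs b. agree M x y \<longrightarrow> agree N (f x) (f y)"
    if x: "x \<in> seqs b" for x N
  proof -
    have "agree N (f x) (f y)" if y: "y \<in> seqs b" and a: "agree (n + N) x y" for y
    proof -
      have eq: "prefix_val b n x = prefix_val b n y"
        by (intro prefix_val_agree agree_mono[OF a]) simp
      have "agree N (tail x) (tail y)"
        using agree_shift[OF a] by (simp add: tail_def eq)
      then have "agree (k + N) (f x) (f y)"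
        using x y by (simp add: f eq agree_join_iff)
      then show ?thesis by (rule agree_mono) simp
    qed
    then show ?thesis by blast
  qed
  ultimately have "f \<in> C_sur b"
    unfolding C_sur_iff by (simp add: f_def)
  moreover have "(\<lambda>i. pullback b f (cut b k i)) ` {0<..<b ^ k} = Y"
  proof -
    have pull: "pullback b f (cut b k (u v)) = cut b n v" if v: "v \<in> V" for v
    proof -
      \<comment> \<open>The index \<open>u v\<close> is first attained at \<open>v\<close>.\<close>
      have "u (prefix_val b n x) < u v \<longleftrightarrow> prefix_val b n x < v" for x
        using u_strict[OF _ v, of "prefix_val b n x"] u_mono[of v "prefix_val b n x"]
        by (cases "prefix_val b n x < v") auto
      then have "f x \<in> cut b k (u v) \<longleftrightarrow> prefix_val b n x < v" if "x \<in> seqs b" for x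
        using that by (simp add: cut_def f_k f_seqs)
      then show ?thesis
        unfolding pullback_def cut_def[of b n v] by (intro Collect_cong conj_cong) auto
    qed
    have "u ` V = {0<..<b ^ k}"
    proof
      show "u ` V \<subseteq> {0<..<b ^ k}"
      proof
        fix i assume "i \<in> u ` V"
        then obtain v where v: "v \<in> V" "i = u v" by blast
        then have "u 0 < u v" using V(1) by (intro u_strict) auto
        then show "i \<in> {0<..<b ^ k}" using v(2) u_less[of v] by simp
      qed
      show "{0<..<b ^ k} \<subseteq> u ` V"
      proof
        fix i assume i: "i \<in> {0<..<b ^ k}"
        then obtain w where w: "w \<in> insert 0 V" "u w = i" using u_surj by auto
        have "{v \<in> V. v \<le> 0} = {}" using V(1) by auto
        then have "u 0 = 0" unfolding u_def by (simp only: card.empty)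
        then have "w \<in> V" using w i by auto
        then show "i \<in> u ` V" using w(2) by blast
      qed
    qed
    then have "(\<lambda>i. pullback b f (cut b k i)) ` {0<..<b ^ k} =
        (\<lambda>i. pullback b f (cut b k i)) ` u ` V"
      by simp
    also have "\<dots> = Y" unfolding V(2) image_image using pull by (rule image_cong[OF refl])
    finally show ?thesis .
  qed
  ultimately show ?thesis by blast
qed

section \<open>The coloring of maps\<close>

lemma agree_of_sup_dist:
  assumes "sup_dist b f g < 1 / 2 ^ n" "x \<in> seqs b"
  shows "agree (Suc n) (f x) (g x)"
proof -
  have "bdd_above ((\<lambda>x. seq_dist (f x) (g x)) ` seqs b)"
    by (rule bdd_aboveI[of _ 1]) (auto simp: seq_dist_def)
  then have "seq_dist (f x) (g x) \<le> sup_dist b f g"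
    unfolding sup_dist_def using assms(2) by (intro cSUP_upper)
  then have "seq_dist (f x) (g x) < 1 / 2 ^ n" using assms(1) by linarith
  then show ?thesis by (simp add: seq_dist_less_iff)
qed

lemma dense_in_itself_pullback:
  assumes "h \<in> C_sur b" "2 \<le> b"
  shows "dense_in_itself (pullback b h ` cuts b)"
  unfolding dense_in_itself_def
proof (intro ballI impI)
  fix a c assume "a \<in> pullback b h ` cuts b" "c \<in> pullback b h ` cuts b" "a < c"
  then obtain D D' where D: "D \<in> cuts b" "D' \<in> cuts b" "a = pullback b h D" "c = pullback b h D'"
    by blast
  with \<open>a < c\<close> have "D < D'" using pullback_less_iff[OF assms(1)] by simp
  then obtain E where "E \<in> cuts b" "D < E" "E < D'"
    using dense_in_itselfD[OF dense_in_itself_cuts[OF assms(2)] D(1,2)] by blast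
  then show "\<exists>s\<in>pullback b h ` cuts b. a < s \<and> s < c"
    using pullback_less_iff[OF assms(1)] D by (intro bexI[of _ "pullback b h E"]) auto
qed

theorem proposition15:
  fixes b :: nat and \<epsilon> :: real
  assumes "b \<ge> 2" and "\<epsilon> > 0"
  shows "\<exists>c \<in> C_sur b \<rightarrow> {0..<num_colors b \<epsilon>}. \<forall>B \<subseteq> {0..<num_colors b \<epsilon>}.
           (\<exists>h \<in> C_sur b. \<forall>f \<in> C_sur b. \<exists>g \<in> C_sur b.
              sup_dist b (compose (seqs b) f h) g < \<epsilon> \<and> c g \<in> B)
           \<longrightarrow> B = {0..<num_colors b \<epsilon>}"
proof (cases "\<epsilon> \<le> 1")
  case False
  then have "num_colors b \<epsilon> = 1" by (simp add: num_colors_def)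
  \<comment> \<open>Only one color is left, and the premise, applied to \<open>f = h\<close>, shows
    that \<open>B\<close> is nonempty.\<close>
  then show ?thesis by (intro bexI[of _ "\<lambda>_. 0"]) auto
next
  case True
  define k where "k = nat (\<lfloor>log 2 (1 / \<epsilon>)\<rfloor> + 1)"
  \<comment> \<open>A single block of \<open>b ^ k - 1\<close> cuts is consumed by
    \<open>b ^ k - 1\<close> deletions and one split fewer.\<close>
  define l where "l = 2 * (b ^ k - 1) - 1"
  define K where "K = num_colors b \<epsilon>"
  have "0 \<le> log 2 (1 / \<epsilon>)" using True assms(2) by simp
  \<comment> \<open>With \<open>k' = k - 1\<close>, distance below \<open>\<epsilon>\<close> is
    distance below \<open>1 / 2 ^ k'\<close>, which forces agreement on \<open>k' + 1 = k\<close>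
    digits.\<close>
  then obtain k' where k': "k = Suc k'" "real k' = \<lfloor>log 2 (1 / \<epsilon>)\<rfloor>"
    by (intro that[of "nat \<lfloor>log 2 (1 / \<epsilon>)\<rfloor>"]) (simp_all add: k_def nat_add_distrib)
  have "real k' \<le> log 2 (1 / \<epsilon>)" unfolding k'(2) by simp
  then have "2 powr real k' \<le> 1 / \<epsilon>" using assms(2) by (simp add: le_log_iff)
  then have eps: "\<epsilon> \<le> 1 / 2 ^ k'"
    using assms(2) by (simp add: powr_realpow field_simps)
  have "b ^ 1 \<le> b ^ k" using assms(1) k' by (intro power_increasing) auto
  then have bk: "2 \<le> b ^ k" using assms(1) by simp
  have K: "K = walks l 1"
    using True by (simp add: K_def num_colors_def odd_tangent_eq_walks l_def k_def)
  have l: "l = Suc (2 * (b ^ k - 2))" using bk by (simp add: l_def)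
  have "0 < K" unfolding K l by (rule walks_odd_pos)
  define Q where "Q = cuts b"
  define r where "r = to_nat_on Q"
  have inj: "inj_on r Q" unfolding r_def Q_def by (intro inj_on_to_nat_on countable_cuts)
  define pulls where "pulls g = (\<lambda>i. pullback b g (cut b k i)) ` {0<..<b ^ k}" for g
  \<comment> \<open>The default \<open>0\<close> keeps \<open>c\<close> in range for sets of cuts
    whose code is not below \<open>K\<close>.\<close>
  define c where "c g = (let v = colour Q r l [pulls g] in if v < K then v else 0)" for g
  have "B = {0..<K}" if B: "B \<subseteq> {0..<K}" and h: "h \<in> C_sur b"
    and hit: "\<forall>f \<in> C_sur b. \<exists>g \<in> C_sur b. sup_dist b (compose (seqs b) f h) g < \<epsilon> \<and> c g \<in> B"
    for B h
  proof -
    have "v \<in> B" if v: "v < K" for v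
    proof -
      define S where "S = pullback b h ` cuts b"
      have SQ: "S \<subseteq> Q"
        using pullback_in_cuts[OF h] assms(1) by (auto simp: S_def Q_def)
      have dense: "dense_in_itself S"
        unfolding S_def using h assms(1) by (rule dense_in_itself_pullback)
      \<comment> \<open>The construction starts from an interval between two cuts. Level 2 is used
        because for \<open>b = 2\<close> level 1 has only one proper cut.\<close>
      have "2 ^ 2 \<le> b ^ 2" using assms(1) by (intro power_mono) auto
      then have "cut b 2 1 \<in> cuts b" "cut b 2 2 \<in> cuts b" "cut b 2 1 < cut b 2 2"
        using assms(1) by (auto simp: cut_less_iff intro!: cut_in_cuts)
      then have interval: "pullback b h (cut b 2 1) \<in> S" "pullback b h (cut b 2 2) \<in> S"
        "pullback b h (cut b 2 1) < pullback b h (cut b 2 2)"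
        using pullback_less_iff[OF h] by (auto simp: S_def)
      have "\<exists>Xs. list_all2 (good_block Q r S 0)
            [(pullback b h (cut b 2 1), pullback b h (cut b 2 2))] Xs \<and>
          colour Q r l Xs = v \<and> 2 * sum_list (map card Xs) =
          l + length [(pullback b h (cut b 2 1), pullback b h (cut b 2 2))]"
        using v interval by (intro colour_persistent[OF SQ dense inj]) (simp_all add: K)
      then obtain X where X: "good_block Q r S 0 (pullback b h (cut b 2 1), pullback b h (cut b 2 2)) X"
        "colour Q r l [X] = v" "2 * card X = l + 1"
        by (auto simp: list_all2_Cons1)
      have "X \<subseteq> pullback b h ` cuts b" "finite X" using X(1) by (auto simp: good_block_def S_def)
      then obtain Y where Y: "Y \<subseteq> cuts b" "X = pullback b h ` Y" by (meson subset_imageE)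
      have inj_Y: "inj_on (pullback b h) Y" using inj_on_pullback[OF h] Y(1) by (rule inj_on_subset)
      have "finite Y" using \<open>finite X\<close> inj_Y Y(2) finite_imageD by blast
      moreover have "Suc (card Y) = b ^ k"
        using X(3) bk unfolding Y(2) card_image[OF inj_Y] l by simp
      \<comment> \<open>This \<open>f\<close> is chosen so that the cuts of the composition of
        \<open>f\<close> with \<open>h\<close> form the set \<open>X\<close> of color
        \<open>v\<close>.\<close>
      ultimately obtain f where f: "f \<in> C_sur b" "pulls f = Y"
        using cuts_realised[OF assms(1) _ Y(1)] unfolding pulls_def by blast
      obtain g where g: "g \<in> C_sur b" "sup_dist b (compose (seqs b) f h) g < \<epsilon>" "c g \<in> B"
        using hit f(1) by blast
      have eq: "prefix_val b k (g x) = prefix_val b k (f (h x))" if "x \<in> seqs b" for x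
      proof -
        have "sup_dist b (compose (seqs b) f h) g < 1 / 2 ^ k'"
          using g(2) eps by linarith
        then have "agree k (compose (seqs b) f h x) (g x)"
          unfolding k'(1) using that by (rule agree_of_sup_dist)
        then have "agree k (f (h x)) (g x)" unfolding compose_eq[OF that] .
        then show ?thesis by (rule prefix_val_agree[symmetric])
      qed
      have "pullback b g (cut b k i) = pullback b h (pullback b f (cut b k i))" for i
      proof -
        have "g x \<in> cut b k i \<longleftrightarrow> h x \<in> pullback b f (cut b k i)" if "x \<in> seqs b" for x
          using that eq[OF that] C_sur_in_seqs[OF g(1) that] C_sur_in_seqs[OF h that]
            C_sur_in_seqs[OF f(1) C_sur_in_seqs[OF h that]]
          by (simp add: pullback_def cut_def)
        then show ?thesis
          unfolding pullback_def[of b g] pullback_def[of b h] by (intro Collect_cong conj_cong) auto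
      qed
      \<comment> \<open>Only the first \<open>k\<close> digits of \<open>g\<close> enter
        \<open>pulls g\<close>, and they are those of the composition.\<close>
      then have "pulls g = pullback b h ` pulls f"
        unfolding pulls_def image_image by simp
      then have "c g = v" using f(2) X(2) v by (simp add: c_def Y(2))
      then show ?thesis using g(3) by simp
    qed
    then show ?thesis using B by auto
  qed
  moreover have "c \<in> C_sur b \<rightarrow> {0..<K}" using \<open>0 < K\<close> by (auto simp: c_def Let_def)
  ultimately show ?thesis unfolding K_def[symmetric] by (intro bexI[of _ c] allI impI) (elim bexE, blast+)
qed

end
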